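(* Let $p=4m$, let $\Lambda=(\lambda_1,\ldots,\lambda_n)$ be a configuration of vectors in $\mathbb{H}^m\simeq\mathbb{R}^p$, let $I\subset\{1,\ldots,n\}$ and let $q\in E_I^*$. The isotropy subgroup of $q$ for the action $\Phi$ of $\mathbb{R}^p$ on $\mathbb{H}^n$ is the vector subspace $$K_I=\{T\in\mathbb{R}^p:\ \langle\lambda_i,T\rangle=0\text{ for every }i\in I\}.$$ Consequently the orbit through $q$ is naturally diffeomorphic to $$\mathbb{R}^p/K_I\cong\mathbb{R}^{\rho(I)},\qquad \rho(I)=\operatorname{rank}_{\mathbb R}\{\lambda_i:i\in I\}.$$ In particular its dimension depends only on the support.
   Context: $\mathbb{H}$ denotes the quaternions. The action of $T\in\mathbb{R}^p$ is $$\Phi_T(q_1,\ldots,q_n)=\big(e^{\langle\lambda_1,T\rangle}q_1,\ldots,e^{\langle\lambda_n,T\rangle}q_n\big).$$ For $I\subset\{1,\ldots,n\}$, $E_I^*=\{q\in\mathbb{H}^n:\ q_j=0\text{ for }j\notin I,\ q_j\ne0\text{ for }j\in I\}$. The support of $q$ is $\{j:q_j\ne0\}$. *)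

theory Defs
  imports "HOL-Analysis.Analysis" "HOL-Algebra.Group_Action"
begin

section \<open>The quaternions\<close>

datatype quat = Quat (qRe: real) (qI: real) (qJ: real) (qK: real)

lemma quat_eq_iff: "x = y \<longleftrightarrow> qRe x = qRe y \<and> qI x = qI y \<and> qJ x = qJ y \<and> qK x = qK y"
  by (auto intro: quat.expand)

instantiation quat :: real_vector
begin

definition "0 = Quat 0 0 0 0"
definition "x + y = Quat (qRe x + qRe y) (qI x + qI y) (qJ x + qJ y) (qK x + qK y)"
definition "- x = Quat (- qRe x) (- qI x) (- qJ x) (- qK x)"
definition "x - y = Quat (qRe x - qRe y) (qI x - qI y) (qJ x - qJ y) (qK x - qK y)"
definition "r *\<^sub>R x = Quat (r * qRe x) (r * qI x) (r * qJ x) (r * qK x)"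

lemma quat_vector_sel [simp]:
  "qRe 0 = 0" "qI 0 = 0" "qJ 0 = 0" "qK 0 = 0"
  "qRe (x + y) = qRe x + qRe y" "qI (x + y) = qI x + qI y"
  "qJ (x + y) = qJ x + qJ y" "qK (x + y) = qK x + qK y"
  "qRe (- x) = - qRe x" "qI (- x) = - qI x" "qJ (- x) = - qJ x" "qK (- x) = - qK x"
  "qRe (x - y) = qRe x - qRe y" "qI (x - y) = qI x - qI y"
  "qJ (x - y) = qJ x - qJ y" "qK (x - y) = qK x - qK y"
  "qRe (r *\<^sub>R x) = r * qRe x" "qI (r *\<^sub>R x) = r * qI x"
  "qJ (r *\<^sub>R x) = r * qJ x" "qK (r *\<^sub>R x) = r * qK x"
  by (simp_all add: zero_quat_def plus_quat_def uminus_quat_def minus_quat_def scaleR_quat_def)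

instance
  by standard (simp_all add: quat_eq_iff distrib_left distrib_right)

end

instantiation quat :: real_algebra_1
begin

definition "1 = Quat 1 0 0 0"

definition "x * y = Quat
  (qRe x * qRe y - qI x * qI y - qJ x * qJ y - qK x * qK y)
  (qRe x * qI y + qI x * qRe y + qJ x * qK y - qK x * qJ y)
  (qRe x * qJ y - qI x * qK y + qJ x * qRe y + qK x * qI y)
  (qRe x * qK y + qI x * qJ y - qJ x * qI y + qK x * qRe y)"

lemma quat_algebra_sel [simp]:
  "qRe 1 = 1" "qI 1 = 0" "qJ 1 = 0" "qK 1 = 0"
  "qRe (x * y) = qRe x * qRe y - qI x * qI y - qJ x * qJ y - qK x * qK y"
  "qI (x * y) = qRe x * qI y + qI x * qRe y + qJ x * qK y - qK x * qJ y"
  "qJ (x * y) = qRe x * qJ y - qI x * qK y + qJ x * qRe y + qK x * qI y"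
  "qK (x * y) = qRe x * qK y + qI x * qJ y - qJ x * qI y + qK x * qRe y"
  by (simp_all add: one_quat_def times_quat_def)

instance
  by standard (simp_all add: quat_eq_iff algebra_simps)

end

instantiation quat :: real_inner
begin

definition "inner x y = qRe x * qRe y + qI x * qI y + qJ x * qJ y + qK x * qK y"
definition "norm x = sqrt (inner x x)" for x :: quat
definition "sgn x = x /\<^sub>R norm x" for x :: quat
definition "dist x y = norm (x - y)" for x y :: quat
definition "(uniformity :: (quat \<times> quat) filter) =
  (INF e\<in>{0 <..}. principal {(x, y). dist x y < e})"
definition "open U \<longleftrightarrow> (\<forall>x\<in>U. eventually (\<lambda>(x', y). x' = x \<longrightarrow> y \<in> U) uniformity)"
  for U :: "quat set"

instance
proof
  fix x y z :: quat and r :: real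
  show "inner x y = inner y x"
    by (simp add: inner_quat_def mult.commute)
  show "inner (x + y) z = inner x z + inner y z" "inner (r *\<^sub>R x) y = r * inner x y"
    by (simp_all add: inner_quat_def algebra_simps)
  show "0 \<le> inner x x"
    by (simp add: inner_quat_def)
  show "inner x x = 0 \<longleftrightarrow> x = 0"
    by (simp add: inner_quat_def quat_eq_iff add_nonneg_eq_0_iff)
qed (rule norm_quat_def sgn_quat_def dist_quat_def uniformity_quat_def open_quat_def)+

end

instantiation quat :: euclidean_space
begin

definition "Basis = {Quat 1 0 0 0, Quat 0 1 0 0, Quat 0 0 1 0, Quat 0 0 0 1}"

instance
proof
  fix u v x :: quat
  show "(Basis :: quat set) \<noteq> {}" "finite (Basis :: quat set)"
    by (simp_all add: Basis_quat_def)
  show "(\<forall>u\<in>Basis. inner x u = 0) \<longleftrightarrow> x = 0"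
    by (simp add: Basis_quat_def inner_quat_def) (simp add: quat_eq_iff)
  assume "u \<in> Basis" "v \<in> Basis"
  then show "inner u v = (if u = v then 1 else 0)"
    unfolding Basis_quat_def by (elim insertE emptyE) (simp_all add: inner_quat_def)
qed

end

instantiation quat :: real_normed_div_algebra
begin

definition "inverse x = Quat (qRe x) (- qI x) (- qJ x) (- qK x) /\<^sub>R inner x x"
definition "x div y = x * inverse y" for x y :: quat

instance
proof
  fix x y :: quat
  show "inverse 0 = (0::quat)"
    by (simp add: inverse_quat_def)
  show "x div y = x * inverse y"
    by (rule divide_quat_def)
  have "inner (x * y) (x * y) = inner x x * inner y y"
    by (simp add: inner_quat_def algebra_simps)
  then show "norm (x * y) = norm x * norm y"
    by (simp add: norm_quat_def real_sqrt_mult)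
  assume "x \<noteq> 0"
  then have nz: "inner x x \<noteq> 0" by simp
  let ?c = "Quat (qRe x) (- qI x) (- qJ x) (- qK x)"
  have "?c * x = inner x x *\<^sub>R 1" "x * ?c = inner x x *\<^sub>R 1"
    by (simp_all add: quat_eq_iff inner_quat_def algebra_simps)
  with nz show "inverse x * x = 1" "x * inverse x = 1"
    by (simp_all add: inverse_quat_def)
qed

end

lemma DIM_quat [simp]: "DIM(quat) = 4"
  by (simp add: Basis_quat_def)

lemma DIM_quat_vec: "DIM(quat ^ 'm) = 4 * CARD('m::finite)"
  by simp

text \<open>
  \<open>\<real>\<^sup>p \<simeq> \<bbbH>\<^sup>m\<close>: an isometric real-linear isomorphism, for the real inner product
  \<open>\<langle>x, y\<rangle> = \<Sum>\<^sub>a Re (x\<^sub>a * conj y\<^sub>a)\<close> on \<open>\<bbbH>\<^sup>m\<close> (the library instance on vectors).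
\<close>

definition isometric_identification ::
    "('a::real_inner \<Rightarrow> 'b::real_inner) \<Rightarrow> bool" where
  "isometric_identification \<iota> \<longleftrightarrow> linear \<iota> \<and> bij \<iota> \<and> (\<forall>x y. \<iota> x \<bullet> \<iota> y = x \<bullet> y)"


section \<open>The action\<close>

definition additive_group :: "'v::ab_group_add monoid" where
  "additive_group = \<lparr>carrier = UNIV, mult = (+), one = 0\<rparr>"

definition \<Phi> :: "('n::finite \<Rightarrow> 'v::real_inner) \<Rightarrow> 'v \<Rightarrow> quat ^ 'n \<Rightarrow> quat ^ 'n" where
  "\<Phi> lam T q = (\<chi> j. exp (lam j \<bullet> T) *\<^sub>R q $ j)"

definition supp :: "quat ^ 'n \<Rightarrow> 'n set" where
  "supp q = {j. q $ j \<noteq> 0}"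

definition E_star :: "'n set \<Rightarrow> (quat ^ 'n) set" where
  "E_star I = {q. (\<forall>j. j \<notin> I \<longrightarrow> q $ j = 0) \<and> (\<forall>j\<in>I. q $ j \<noteq> 0)}"

definition K_space :: "('n \<Rightarrow> 'v::real_inner) \<Rightarrow> 'n set \<Rightarrow> 'v set" where
  "K_space lam I = {T. \<forall>i\<in>I. lam i \<bullet> T = 0}"

text \<open>\<open>dim\<close> of a set is the real dimension of its linear span.\<close>

definition rho :: "('n \<Rightarrow> 'v::real_inner) \<Rightarrow> 'n set \<Rightarrow> nat" where
  "rho lam I = dim (lam ` I)"

abbreviation Phi_orbit ::
    "('n::finite \<Rightarrow> 'v::real_inner) \<Rightarrow> quat ^ 'n \<Rightarrow> (quat ^ 'n) set" where
  "Phi_orbit lam q \<equiv> orbit additive_group (\<Phi> lam) q"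

abbreviation Phi_isotropy ::
    "('n::finite \<Rightarrow> 'v::real_inner) \<Rightarrow> quat ^ 'n \<Rightarrow> 'v set" where
  "Phi_isotropy lam q \<equiv> stabilizer additive_group (\<Phi> lam) q"

lemma group_additive_group: "group (additive_group :: 'v::ab_group_add monoid)"
  by (rule groupI) (auto simp: additive_group_def add.assoc intro: exI[of _ "- _"])

lemma group_action_Phi: "group_action additive_group UNIV (\<Phi> lam)"
proof -
  have comp: "\<Phi> lam (S + T) = \<Phi> lam S \<circ> \<Phi> lam T" for S T
    by (rule ext) (simp add: \<Phi>_def vec_eq_iff inner_add_right exp_add)
  have zero: "\<Phi> lam 0 = id"
    by (rule ext) (simp add: \<Phi>_def vec_eq_iff)
  have "bij (\<Phi> lam T)" for T
    by (rule o_bij[of "\<Phi> lam (- T)"]) (simp_all flip: comp add: zero)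
  then have "\<Phi> lam \<in> hom additive_group (BijGroup UNIV)"
    by (auto simp: hom_def BijGroup_def Bij_def additive_group_def comp compose_def fun_eq_iff)
  then show ?thesis
    unfolding group_action_def group_hom_def group_hom_axioms_def
    by (simp add: group_additive_group group_BijGroup)
qed


section \<open>The quotient vector space \<open>\<real>\<^sup>p / K\<close>\<close>

abbreviation quotient :: "'v::ab_group_add set \<Rightarrow> 'v set set" where
  "quotient K \<equiv> carrier (additive_group Mod K)"

abbreviation coset :: "'v::ab_group_add set \<Rightarrow> 'v \<Rightarrow> 'v set" where
  "coset K T \<equiv> K #>\<^bsub>additive_group\<^esub> T"

text \<open>\<open>c \<cdot> (K + T) = K + c T\<close>; adding \<open>K\<close> back in matters only for \<open>c = 0\<close>.\<close>

definition quotient_scale :: "'v::real_vector set \<Rightarrow> real \<Rightarrow> 'v set \<Rightarrow> 'v set" where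
  "quotient_scale K c A = (\<Union>T\<in>A. coset K (c *\<^sub>R T))"

definition quotient_linear_iso ::
    "'v::real_vector set \<Rightarrow> 'e::real_vector set \<Rightarrow> ('v set \<Rightarrow> 'e) \<Rightarrow> bool" where
  "quotient_linear_iso K V L \<longleftrightarrow>
     bij_betw L (quotient K) V \<and>
     (\<forall>A\<in>quotient K. \<forall>B\<in>quotient K. L (A \<otimes>\<^bsub>additive_group Mod K\<^esub> B) = L A + L B) \<and>
     (\<forall>c. \<forall>A\<in>quotient K. L (quotient_scale K c A) = c *\<^sub>R L A)"


section \<open>Smooth maps, diffeomorphisms and dimension\<close>

fun C_k_on :: "nat \<Rightarrow> ('a::real_normed_vector \<Rightarrow> 'b::real_normed_vector) \<Rightarrow> 'a set \<Rightarrow> bool" where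
  "C_k_on 0 f U \<longleftrightarrow> continuous_on U f"
| "C_k_on (Suc k) f U \<longleftrightarrow>
     (\<forall>x\<in>U. f differentiable (at x)) \<and>
     (\<forall>v. C_k_on k (\<lambda>x. frechet_derivative f (at x) v) U)"

text \<open>
  For open \<open>U\<close> in a Euclidean space this is \<open>C\<^sup>\<infinity>\<close>: all iterated directional derivatives exist
  and are continuous.
\<close>

definition C_infinity_on ::
    "('a::real_normed_vector \<Rightarrow> 'b::real_normed_vector) \<Rightarrow> 'a set \<Rightarrow> bool" where
  "C_infinity_on f U \<longleftrightarrow> (\<forall>k. C_k_on k f U)"

text \<open>
  Smoothness on an arbitrary subset of a Euclidean space (Milnor): locally the restriction of a
  smooth map defined on an open set of the ambient space.
\<close>

definition smooth_map_on ::
    "'a::euclidean_space set \<Rightarrow> ('a \<Rightarrow> 'b::euclidean_space) \<Rightarrow> bool" where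
  "smooth_map_on X f \<longleftrightarrow>
     (\<forall>x\<in>X. \<exists>U g. open U \<and> x \<in> U \<and> C_infinity_on g U \<and> (\<forall>z\<in>U \<inter> X. g z = f z))"

definition diffeomorphism ::
    "'a::euclidean_space set \<Rightarrow> 'b::euclidean_space set \<Rightarrow> ('a \<Rightarrow> 'b) \<Rightarrow> bool" where
  "diffeomorphism X Y f \<longleftrightarrow>
     bij_betw f X Y \<and> smooth_map_on X f \<and> smooth_map_on Y (inv_into X f)"

text \<open>
  A copy of \<open>\<real>\<^sup>d\<close> for a number \<open>d\<close> that is not a type: the span of \<open>d\<close> of the standard basis
  vectors of a Euclidean space. In \<^typ>\<open>real ^ 'r\<close> with \<open>CARD('r) = d\<close> the only such set is
  \<^term>\<open>UNIV\<close>; for \<open>d = 0\<close> it is \<open>{0}\<close>.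
\<close>

definition coordinate_space :: "nat \<Rightarrow> 'a::euclidean_space set \<Rightarrow> bool" where
  "coordinate_space d V \<longleftrightarrow> (\<exists>B\<subseteq>Basis. card B = d \<and> V = span B)"

text \<open>Submanifold of dimension \<open>d\<close>: locally diffeomorphic to open subsets of \<open>\<real>\<^sup>d\<close> (Milnor).\<close>

definition smooth_submanifold :: "nat \<Rightarrow> 'a::euclidean_space set \<Rightarrow> bool" where
  "smooth_submanifold d M \<longleftrightarrow>
     (\<exists>V::'a set. coordinate_space d V \<and>
       (\<forall>x\<in>M. \<exists>W U f. open W \<and> x \<in> W \<and> openin (top_of_set V) U \<and>
          diffeomorphism U (M \<inter> W) f))"

definition manifold_dim :: "'a::euclidean_space set \<Rightarrow> nat" where
  "manifold_dim M = (THE d. smooth_submanifold d M)"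

end

theory Submission
  imports Defs "HOL-Homology.Invariance_of_Domain"
begin

text \<open>
  \<open>\<Phi> T q\<close> determines and is determined by the numbers \<open>\<langle>\<lambda>\<^sub>j, T\<rangle>\<close> for \<open>j \<in> I\<close>, smoothly in both
  directions: through exponentials one way, and through logarithms of the ratios
  \<open>\<langle>y\<^sub>j, q\<^sub>j\<rangle> / \<langle>q\<^sub>j, q\<^sub>j\<rangle>\<close> the other way. A linear map with kernel \<open>K\<^sub>I\<close> is a linear function of these
  numbers, so its image is diffeomorphic to the orbit. The dimension of a submanifold is unique by
  invariance of domain.
\<close>

section \<open>Smooth maps\<close>

text \<open>A derivative depends only on values near the point, and \<open>U\<close> is open. The
  induction generalises over both functions because its step passes to their derivatives.\<close>

lemma C_k_on_cong:
  assumes "open U" "\<And>x. x \<in> U \<Longrightarrow> f x = g x" "C_k_on k f U"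
  shows "C_k_on k g U"
  using assms(2,3)
proof (induction k arbitrary: f g)
  case 0
  then show ?case
    by (simp add: continuous_on_eq)
next
  case (Suc k)
  have D: "(g has_derivative frechet_derivative f (at x)) (at x)" if "x \<in> U" for x
  proof (rule has_derivative_transform_within_open[of f _ _ _ U])
    show "(f has_derivative frechet_derivative f (at x)) (at x)"
      using Suc.prems(2) that by (simp add: frechet_derivative_works)
  qed (use assms(1) that Suc.prems(1) in auto)
  have "C_k_on k (\<lambda>x. frechet_derivative g (at x) v) U" for v
  proof (rule Suc.IH)
    show "C_k_on k (\<lambda>x. frechet_derivative f (at x) v) U"
      using Suc.prems(2) by simp
    show "frechet_derivative f (at x) v = frechet_derivative g (at x) v" if "x \<in> U" for x
      using frechet_derivative_at[OF D[OF that]] by (rule fun_cong)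
  qed
  then show ?case
    using D by (auto simp: differentiable_def)
qed

text \<open>Derivatives are unique, so an explicit formula \<open>f'\<close> may stand in for
  \<open>frechet_derivative\<close>, about which nothing else is known.\<close>

lemma C_k_on_SucI:
  assumes "open U" "\<And>x. x \<in> U \<Longrightarrow> (f has_derivative f' x) (at x)"
    "\<And>v. C_k_on k (\<lambda>x. f' x v) U"
  shows "C_k_on (Suc k) f U"
proof -
  have "C_k_on k (\<lambda>x. frechet_derivative f (at x) v) U" for v
    by (rule C_k_on_cong[OF assms(1) _ assms(3)[of v]])
       (simp flip: frechet_derivative_at[OF assms(2)])
  then show ?thesis
    using assms(2) by (auto simp: differentiable_def)
qed

lemma C_k_on_sum:
  assumes "open U" "\<And>j. j \<in> J \<Longrightarrow> C_k_on k (f j) U"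
  shows "C_k_on k (\<lambda>x. \<Sum>j\<in>J. f j x) U"
  using assms(2)
proof (induction k arbitrary: f)
  case 0
  then show ?case by (auto intro!: continuous_on_sum)
next
  case (Suc k)
  show ?case
  proof (rule C_k_on_SucI[OF assms(1)])
    show "((\<lambda>x. \<Sum>j\<in>J. f j x) has_derivative
        (\<lambda>v. \<Sum>j\<in>J. frechet_derivative (f j) (at x) v)) (at x)" if "x \<in> U" for x
      using Suc.prems that
      by (intro has_derivative_sum) (auto simp: frechet_derivative_works)
    show "C_k_on k (\<lambda>x. \<Sum>j\<in>J. frechet_derivative (f j) (at x) v) U" for v
      using Suc.prems by (intro Suc.IH) auto
  qed
qed

text \<open>Listing all derivatives \<open>g 0, g 1, \<dots>\<close> makes the class of maps closed under directional
  derivatives, which spares a product and a chain rule for \<^const>\<open>C_k_on\<close>.\<close>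

lemma C_infinity_on_scaleR_bounded_linear:
  fixes g :: "nat \<Rightarrow> real \<Rightarrow> real"
  assumes "open U" "bounded_linear \<phi>"
    "\<And>i x. x \<in> U \<Longrightarrow> (g i has_real_derivative g (Suc i) (\<phi> x)) (at (\<phi> x))"
  shows "C_infinity_on (\<lambda>x. g i (\<phi> x) *\<^sub>R c) U"
proof -
  have D: "((\<lambda>x. g i (\<phi> x) *\<^sub>R c) has_derivative
      (\<lambda>v. g (Suc i) (\<phi> x) *\<^sub>R (\<phi> v *\<^sub>R c))) (at x)" if "x \<in> U" for i x c
  proof -
    have "((\<lambda>x. g i (\<phi> x)) has_derivative (\<lambda>v. g (Suc i) (\<phi> x) * \<phi> v)) (at x)"
      using has_derivative_compose[OF bounded_linear_imp_has_derivative[OF assms(2)],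
          of "g i" "(*) (g (Suc i) (\<phi> x))" x UNIV] assms(3)[OF that, of i]
      by (simp add: has_field_derivative_def)
    from has_derivative_scaleR_left[OF this, of c] show ?thesis
      by simp
  qed
  \<comment> \<open>Differentiating in direction \<open>v\<close> moves \<open>i\<close> to
    \<open>Suc i\<close> and replaces the vector \<open>c\<close> by
    \<open>\<phi> v *\<^sub>R c\<close>; hence both must vary in the induction.\<close>
  have "C_k_on k (\<lambda>x. g i (\<phi> x) *\<^sub>R c) U" for k
  proof (induction k arbitrary: i c)
    case 0
    show ?case
      using D by (auto intro!: continuous_at_imp_continuous_on has_derivative_continuous)
  next
    case (Suc k)
    show ?case
      by (rule C_k_on_SucI[OF assms(1) D Suc.IH])
  qed
  then show ?thesis
    by (simp add: C_infinity_on_def)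
qed

lemma C_infinity_on_sum:
  "open U \<Longrightarrow> (\<And>j. j \<in> J \<Longrightarrow> C_infinity_on (f j) U) \<Longrightarrow> C_infinity_on (\<lambda>x. \<Sum>j\<in>J. f j x) U"
  by (simp add: C_infinity_on_def C_k_on_sum)

lemma C_infinity_on_exp:
  assumes "open U" "bounded_linear \<phi>"
  shows "C_infinity_on (\<lambda>x. exp (\<phi> x) *\<^sub>R c) U"
  using C_infinity_on_scaleR_bounded_linear[OF assms, of "\<lambda>_. exp"] by (simp add: DERIV_exp)

lemma C_infinity_on_ln:
  assumes "open U" "bounded_linear \<phi>" "\<And>x. x \<in> U \<Longrightarrow> 0 < \<phi> x"
  shows "C_infinity_on (\<lambda>x. ln (\<phi> x) *\<^sub>R c) U"
proof -
  \<comment> \<open>The entry at \<open>Suc n\<close> is the derivative of \<open>ln\<close> of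
    order n + 1, that is (-1)^n n! / x^(n+1).\<close>
  define g :: "nat \<Rightarrow> real \<Rightarrow> real"
    where "g i = (case i of 0 \<Rightarrow> ln | Suc n \<Rightarrow> (\<lambda>x. (-1) ^ n * fact n * inverse x ^ Suc n))" for i
  have "(g i has_real_derivative g (Suc i) y) (at y)" if "0 < y" for i y
  proof (cases i)
    case 0
    then show ?thesis
      using that by (auto simp: g_def divide_inverse intro!: derivative_eq_intros)
  next
    case (Suc n)
    have "y \<noteq> 0"
      using that by simp
    from DERIV_cmult[OF DERIV_power_Suc[OF DERIV_inverse[OF this], of n], of "(-1) ^ n * fact n"]
    show ?thesis
      by (simp add: g_def Suc algebra_simps)
  qed
  then have "C_infinity_on (\<lambda>x. g 0 (\<phi> x) *\<^sub>R c) U"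
    using assms(3) by (intro C_infinity_on_scaleR_bounded_linear[OF assms(1,2)]) blast
  then show ?thesis
    by (simp add: g_def)
qed

lemma smooth_map_onI:
  assumes "open U" "X \<subseteq> U" "C_infinity_on g U" "\<And>x. x \<in> X \<Longrightarrow> g x = f x"
  shows "smooth_map_on X f"
  unfolding smooth_map_on_def
  using assms by (intro ballI exI[of _ U] exI[of _ g]) auto

text \<open>Continuity is local, and each local extension is of class C^0. Diffeomorphisms thereby
  become homeomorphisms, to which invariance of domain applies.\<close>

lemma smooth_map_on_imp_continuous_on:
  assumes "smooth_map_on X f"
  shows "continuous_on X f"
  unfolding continuous_on_eq_continuous_within
proof
  fix x assume "x \<in> X"
  with assms obtain U g where U: "open U" "x \<in> U" "C_infinity_on g U"
    and eq: "\<And>z. z \<in> U \<inter> X \<Longrightarrow> g z = f z"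
    unfolding smooth_map_on_def by meson
  have "continuous_on U g"
    using U(3) unfolding C_infinity_on_def by (metis C_k_on.simps(1))
  then have "continuous (at x within X) g"
    using U continuous_at_imp_continuous_at_within continuous_on_eq_continuous_at by blast
  moreover have "\<forall>\<^sub>F z in at x within X. g z = f z"
    using eq U \<open>x \<in> X\<close> by (auto simp: eventually_at_topological)
  ultimately show "continuous (at x within X) f"
    using eq[of x] U(2) \<open>x \<in> X\<close> Lim_transform_eventually[of g "g x" "at x within X" f]
    unfolding continuous_within by simp
qed


section \<open>Dimension of a submanifold\<close>

lemma coordinate_space_subspace: "coordinate_space d V \<Longrightarrow> subspace V"
  by (auto simp: coordinate_space_def)

lemma coordinate_space_dim:
  assumes "coordinate_space d V"
  shows "dim V = d"
proof -
  obtain B where "B \<subseteq> Basis" "card B = d" "V = span B"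
    using assms by (auto simp: coordinate_space_def)
  then show ?thesis
    by (metis dim_span_eq_card_independent independent_Basis independent_mono)
qed

text \<open>The transition map between two charts at a common point is a continuous injection of a
  nonempty open part of \<open>V\<close> into \<open>V'\<close>. A point is needed because the empty
  set admits several values of \<open>d\<close>.\<close>

lemma smooth_submanifold_dim_le:
  fixes M :: "'a::euclidean_space set"
  assumes "smooth_submanifold d M" "smooth_submanifold d' M" "M \<noteq> {}"
  shows "d \<le> d'"
proof -
  obtain x where x: "x \<in> M" using assms(3) by auto
  obtain V :: "'a set" and W U f where V: "coordinate_space d V" and W: "open W" "x \<in> W"
    and U: "openin (top_of_set V) U" and f: "diffeomorphism U (M \<inter> W) f"
    using assms(1) x unfolding smooth_submanifold_def by meson
  obtain V' :: "'a set" and W' U' f' where V': "coordinate_space d' V'"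
    and W': "open W'" "x \<in> W'"
    and U': "openin (top_of_set V') U'" and f': "diffeomorphism U' (M \<inter> W') f'"
    using assms(2) x unfolding smooth_submanifold_def by meson
  have bij: "bij_betw f U (M \<inter> W)" "bij_betw f' U' (M \<inter> W')"
    and cont: "continuous_on U f" "continuous_on (M \<inter> W') (inv_into U' f')"
    using f f' by (auto simp: diffeomorphism_def smooth_map_on_imp_continuous_on)
  \<comment> \<open>The part of the first chart domain on which the inverse of the second chart can
    be applied after \<open>f\<close>.\<close>
  define S where "S = U \<inter> f -` W'"
  have "openin (top_of_set U) S"
    unfolding S_def using cont(1) W'(1) by (rule continuous_openin_preimage_gen)
  then have S: "openin (top_of_set V) S"
    using U openin_trans by blast
  have fS: "f ` S \<subseteq> M \<inter> W'" "S \<subseteq> U"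
    using bij(1) by (auto simp: S_def bij_betw_def)
  have "S \<noteq> {}"
  proof -
    obtain u where "u \<in> U" "f u = x"
      using bij_betw_imp_surj_on[OF bij(1)] x W(2) by (metis IntI imageE)
    then show ?thesis using W' by (auto simp: S_def)
  qed
  have inv: "bij_betw (inv_into U' f') (M \<inter> W') U'"
    using bij(2) by (rule bij_betw_inv_into)
  have "dim V \<le> dim V'"
  proof (rule invariance_of_dimension_subspaces[OF S])
    show "continuous_on S (inv_into U' f' \<circ> f)"
      using cont fS by (meson continuous_on_compose continuous_on_subset)
    show "(inv_into U' f' \<circ> f) ` S \<subseteq> V'"
      using inv fS openin_imp_subset[OF U'] by (fastforce simp: bij_betw_def)
    show "inj_on (inv_into U' f' \<circ> f) S"
      using bij(1) fS
      by (intro comp_inj_on inj_on_subset[OF bij_betw_imp_inj_on[OF inv]])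
        (auto simp: bij_betw_def intro: inj_on_subset)
  qed (use V V' \<open>S \<noteq> {}\<close> in \<open>auto intro: coordinate_space_subspace\<close>)
  then show ?thesis
    using V V' by (simp add: coordinate_space_dim)
qed

lemma manifold_dim_eq:
  assumes "smooth_submanifold d M" "M \<noteq> {}"
  shows "manifold_dim M = d"
  unfolding manifold_dim_def
  using assms by (intro the_equality) (auto intro: antisym smooth_submanifold_dim_le)


section \<open>Linear functions on the quotient\<close>

lemma coset_eq_image: "coset K T = (\<lambda>k. k + T) ` K"
  by (auto simp: r_coset_def additive_group_def)

lemma quotient_eq_range: "quotient K = range (coset K)"
  by (auto simp: FactGroup_def RCOSETS_def additive_group_def)

lemma mem_coset_iff: "S \<in> coset K T \<longleftrightarrow> S - T \<in> K"
  by (auto simp: coset_eq_image image_iff) (metis diff_add_cancel)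

lemma coset_eq_iff:
  assumes "subspace K"
  shows "coset K S = coset K T \<longleftrightarrow> S - T \<in> K"
proof
  assume "coset K S = coset K T"
  moreover have "S \<in> coset K S"
    using assms by (simp add: mem_coset_iff subspace_0)
  ultimately show "S - T \<in> K"
    by (simp add: mem_coset_iff)
next
  assume *: "S - T \<in> K"
  have "R - S \<in> K \<longleftrightarrow> R - T \<in> K" for R
    using subspace_add[OF assms _ *, of "R - S"] subspace_diff[OF assms _ *, of "R - T"] by auto
  then show "coset K S = coset K T"
    by (auto simp: mem_coset_iff)
qed

lemma coset_mult:
  assumes "subspace K"
  shows "coset K S <#>\<^bsub>additive_group\<^esub> coset K T = coset K (S + T)"
proof -
  have "(\<exists>k\<in>K. \<exists>l\<in>K. R = (k + S) + (l + T)) \<longleftrightarrow> R - (S + T) \<in> K" for R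
  proof
    assume "R - (S + T) \<in> K"
    then show "\<exists>k\<in>K. \<exists>l\<in>K. R = (k + S) + (l + T)"
      using subspace_0[OF assms] by (intro bexI[of _ "R - (S + T)"] bexI[of _ 0]) auto
  qed (use subspace_add[OF assms] in \<open>auto simp: algebra_simps\<close>)
  moreover have "R \<in> coset K S <#>\<^bsub>additive_group\<^esub> coset K T \<longleftrightarrow>
      (\<exists>k\<in>K. \<exists>l\<in>K. R = (k + S) + (l + T))" for R
    unfolding coset_eq_image by (auto simp: set_mult_def additive_group_def)
  ultimately show ?thesis
    by (auto simp: mem_coset_iff)
qed

text \<open>Scaled members of one coset differ by elements of \<open>K\<close>, so the nonempty
  union defining \<open>quotient_scale\<close> consists of a single coset.\<close>

lemma coset_scale:
  assumes "subspace K"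
  shows "quotient_scale K c (coset K T) = coset K (c *\<^sub>R T)"
proof -
  have "coset K (c *\<^sub>R S) = coset K (c *\<^sub>R T)" if "S \<in> coset K T" for S
    using subspace_scale[OF assms, of "S - T" c] that
    by (simp add: coset_eq_iff[OF assms] mem_coset_iff scaleR_diff_right)
  moreover have "T \<in> coset K T"
    using assms by (simp add: mem_coset_iff subspace_0)
  ultimately show ?thesis
    unfolding quotient_scale_def by blast
qed

text \<open>\<open>F\<close> evaluates \<open>f\<close> at a chosen representative; the second
  assumption makes the choice irrelevant.\<close>

lemma coset_lift:
  assumes "subspace K" "\<And>S T. S - T \<in> K \<Longrightarrow> f S = f T"
  obtains F where "\<And>T. F (coset K T) = f T"
proof
  fix T
  have "T \<in> coset K T"
    using assms by (simp add: mem_coset_iff subspace_0)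
  then have "(SOME S. S \<in> coset K T) \<in> coset K T"
    by (rule someI)
  then show "(\<lambda>A. f (SOME S. S \<in> A)) (coset K T) = f T"
    by (intro assms(2)) (simp add: mem_coset_iff)
qed

text \<open>The fibres of \<open>f\<close> are exactly the cosets. This serves both linear maps with
  kernel \<open>K\<close> and the orbit map.\<close>

lemma bij_betw_quotient:
  assumes "subspace K" "\<And>S T. f S = f T \<longleftrightarrow> S - T \<in> K" "\<And>T. F (coset K T) = f T"
  shows "bij_betw F (quotient K) (range f)"
  unfolding quotient_eq_range bij_betw_def inj_on_def
  using assms by (auto simp: coset_eq_iff image_image)

text \<open>Composing with the projection turns \<open>L\<close> into a linear map on the whole
  space, where smoothness can be discussed. Its kernel follows from injectivity, since 0 is the
  value at the coset of 0.\<close>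

lemma quotient_linear_iso_imp_linear:
  assumes "subspace K" "quotient_linear_iso K V L"
  shows "linear (\<lambda>T. L (coset K T))" "range (\<lambda>T. L (coset K T)) = V"
    "L (coset K T) = 0 \<longleftrightarrow> T \<in> K"
proof -
  have bij: "bij_betw L (quotient K) V"
    and add: "L (coset K S) + L (coset K T) = L (coset K (S + T))"
    and scale: "c *\<^sub>R L (coset K S) = L (coset K (c *\<^sub>R S))" for S T c
    using assms(2) unfolding quotient_linear_iso_def quotient_eq_range
    by (auto simp flip: coset_mult[OF assms(1)] coset_scale[OF assms(1)])
  show lin: "linear (\<lambda>T. L (coset K T))"
    by (rule linearI) (simp_all add: add scale)
  show "range (\<lambda>T. L (coset K T)) = V"
    using bij by (auto simp: bij_betw_def quotient_eq_range)
  have "L (coset K T) = L (coset K 0) \<longleftrightarrow> coset K T = coset K 0"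
    using bij by (auto simp: bij_betw_def quotient_eq_range inj_on_def)
  then show "L (coset K T) = 0 \<longleftrightarrow> T \<in> K"
    using linear_0[OF lin] by (simp add: coset_eq_iff[OF assms(1)])
qed

lemma linear_eq_iff_diff_kernel:
  assumes "linear l" "\<And>T. l T = 0 \<longleftrightarrow> T \<in> K"
  shows "l S = l T \<longleftrightarrow> S - T \<in> K"
  by (simp add: linear_diff[OF assms(1)] flip: assms(2))

text \<open>First isomorphism theorem: \<open>l\<close> descends to the quotient.\<close>

lemma quotient_linear_iso_exists:
  assumes "subspace K" "linear l" "\<And>T. l T = 0 \<longleftrightarrow> T \<in> K" "range l = V"
  shows "\<exists>L. quotient_linear_iso K V L"
proof -
  note eq = linear_eq_iff_diff_kernel[of l K, OF assms(2,3)]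
  obtain L where L: "\<And>T. L (coset K T) = l T"
    using coset_lift[of K l] assms(1) eq by metis
  have "quotient_linear_iso K V L"
    unfolding quotient_linear_iso_def
  proof (intro conjI ballI allI)
    show "bij_betw L (quotient K) V"
      using bij_betw_quotient[OF assms(1) eq L] assms(4) by simp
  qed (auto simp: quotient_eq_range coset_mult coset_scale assms(1) L
        linear_add[OF assms(2)] linear_scale[OF assms(2)])
  then show ?thesis
    by blast
qed


section \<open>Orbits\<close>

lemma E_star_iff_supp: "q \<in> E_star I \<longleftrightarrow> supp q = I"
  by (auto simp: E_star_def supp_def)

lemma Phi_orbit_eq_range: "Phi_orbit lam q = range (\<lambda>T. \<Phi> lam T q)"
  by (auto simp: orbit_def additive_group_def)

lemma subspace_K_space: "subspace (K_space lam I)"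
  by (auto simp: subspace_def K_space_def inner_add_right)

text \<open>Coordinates outside \<open>I\<close> are 0 for both points; on \<open>I\<close> the
  nonzero entries cancel and \<open>exp\<close> is injective.\<close>

lemma Phi_eq_iff:
  assumes "q \<in> E_star I"
  shows "\<Phi> lam S q = \<Phi> lam T q \<longleftrightarrow> S - T \<in> K_space lam I"
  using assms by (auto simp: \<Phi>_def vec_eq_iff K_space_def E_star_def inner_diff_right)

lemma Phi_isotropy_eq:
  assumes "q \<in> E_star I"
  shows "Phi_isotropy lam q = K_space lam I"
proof -
  have "\<Phi> lam 0 q = q"
    by (simp add: \<Phi>_def vec_eq_iff)
  then show ?thesis
    using Phi_eq_iff[OF assms, of lam _ 0] by (auto simp: stabilizer_def additive_group_def)
qed

text \<open>A linear map vanishing on the common kernel of finitely many functionals is a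
  combination of them. The pairings determine the component of \<open>T\<close> in the span of the
  \<open>lam j\<close>, and the orthogonal remainder lies in \<open>K_space lam I\<close>.\<close>

lemma K_space_linear_factor:
  fixes lam :: "'n::finite \<Rightarrow> 'v::euclidean_space" and l :: "'v \<Rightarrow> 'e::euclidean_space"
  assumes "linear l" "\<And>T. T \<in> K_space lam I \<Longrightarrow> l T = 0"
  obtains h where "\<And>T. l T = (\<Sum>j\<in>I. (lam j \<bullet> T) *\<^sub>R h j)"
proof -
  define s :: "'v \<Rightarrow> real ^ 'n" where "s T = (\<Sum>j\<in>I. (lam j \<bullet> T) *\<^sub>R axis j 1)" for T
  have s: "s T $ j = (if j \<in> I then lam j \<bullet> T else 0)" for T j
    by (simp add: s_def axis_def if_distrib cong: if_cong)
  have lin: "linear s"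
    by (rule linearI) (simp_all add: vec_eq_iff s inner_add_right)
  have s0: "s T = 0 \<longleftrightarrow> T \<in> K_space lam I" for T
    by (auto simp: vec_eq_iff s K_space_def)
  have orth: "u \<bullet> k = 0" if "u \<in> span (lam ` I)" "k \<in> K_space lam I" for u k
  proof -
    have "orthogonal k u"
      using that by (intro orthogonal_to_span[of u "lam ` I"])
        (auto simp: K_space_def orthogonal_def inner_commute[of k])
    then show ?thesis by (simp add: orthogonal_def inner_commute)
  qed
  have inj: "inj_on s (span (lam ` I))"
  proof (subst linear_injective_on_subspace_0[OF lin subspace_span], intro ballI impI)
    fix u assume "u \<in> span (lam ` I)" "s u = 0"
    then show "u = 0" using orth[of u u] s0 by simp
  qed
  obtain g where g: "linear g" "\<And>u. u \<in> span (lam ` I) \<Longrightarrow> g (s u) = u"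
    using linear_exists_left_inverse_on[OF lin subspace_span inj] by blast
  have "l T = (\<Sum>j\<in>I. (lam j \<bullet> T) *\<^sub>R l (g (axis j 1)))" for T
  proof -
    obtain u k where u: "u \<in> span (lam ` I)" and k: "\<And>w. w \<in> span (lam ` I) \<Longrightarrow> orthogonal k w"
      and T: "T = u + k"
      using orthogonal_subspace_decomp_exists[of "lam ` I" T] by metis
    have "k \<in> K_space lam I"
      using k[OF span_base] by (auto simp: K_space_def orthogonal_def inner_commute[of _ k])
    \<comment> \<open>Both \<open>l\<close> and \<open>s\<close> kill \<open>k\<close>, so
      \<open>T\<close> may be replaced by \<open>u\<close>, which \<open>g\<close> recovers from
      \<open>s u\<close>.\<close>
    then have "l T = l (g (s T))"
      using u s0[of k] g(2) assms(2)[of k]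
      by (simp add: T linear_add[OF lin] linear_add[OF assms(1)])
    also have "\<dots> = (\<Sum>j\<in>I. (lam j \<bullet> T) *\<^sub>R l (g (axis j 1)))"
      by (simp add: s_def linear_sum[OF g(1)] linear_sum[OF assms(1)]
          linear_scale[OF g(1)] linear_scale[OF assms(1)])
    finally show ?thesis .
  qed
  then show thesis by (rule that)
qed

text \<open>Only the values of \<open>\<psi>\<close> on \<open>range l\<close> are prescribed, so
  the result covers charts of the orbit as well as coordinates on the quotient.\<close>

lemma diffeomorphism_Phi_orbit:
  fixes lam :: "'n::finite \<Rightarrow> 'v::euclidean_space" and l :: "'v \<Rightarrow> 'e::euclidean_space"
  assumes q: "q \<in> E_star I" and lin: "linear l"
    and ker: "\<And>T. l T = 0 \<longleftrightarrow> T \<in> K_space lam I"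
    and \<psi>: "\<And>T. \<psi> (l T) = \<Phi> lam T q"
  shows "diffeomorphism (range l) (Phi_orbit lam q) \<psi>"
proof -
  note eq = linear_eq_iff_diff_kernel[of l "K_space lam I", OF lin ker]
  have bij: "bij_betw \<psi> (range l) (Phi_orbit lam q)"
    unfolding bij_betw_def inj_on_def Phi_orbit_eq_range
    by (auto simp: \<psi> Phi_eq_iff[OF q] eq image_image)
  have inv: "inv_into (range l) \<psi> (\<Phi> lam T q) = l T" for T
    using bij by (simp add: bij_betw_def inv_into_f_f flip: \<psi>)
  \<comment> \<open>The linear section \<open>r\<close> of \<open>l\<close> gives
    \<open>\<psi>\<close> an extension by exponentials to the whole ambient space.\<close>
  obtain r where r: "linear r" "\<And>v. v \<in> range l \<Longrightarrow> l (r v) = v"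
    using linear_exists_right_inverse_on[OF lin subspace_UNIV] by auto
  have "smooth_map_on (range l) \<psi>"
  proof (rule smooth_map_onI[OF open_UNIV subset_UNIV])
    show "C_infinity_on (\<lambda>v. \<Sum>j\<in>UNIV. exp (lam j \<bullet> r v) *\<^sub>R axis j (q $ j)) UNIV"
      using r(1) by (intro C_infinity_on_sum C_infinity_on_exp open_UNIV
          bounded_linear_inner_right_comp) (simp_all add: linear_linear)
    have "\<Phi> lam T q = (\<Sum>j\<in>UNIV. exp (lam j \<bullet> T) *\<^sub>R axis j (q $ j))" for T
      by (simp add: \<Phi>_def vec_eq_iff axis_def if_distrib cong: if_cong)
    then show "(\<Sum>j\<in>UNIV. exp (lam j \<bullet> r v) *\<^sub>R axis j (q $ j)) = \<psi> v" if "v \<in> range l" for v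
      using \<psi>[of "r v"] r(2)[OF that] by simp
  qed
  moreover have "smooth_map_on (Phi_orbit lam q) (inv_into (range l) \<psi>)"
  proof -
    obtain h where h: "\<And>T. l T = (\<Sum>j\<in>I. (lam j \<bullet> T) *\<^sub>R h j)"
      using K_space_linear_factor[OF lin, of lam I] ker by metis
    \<comment> \<open>On the orbit, entry \<open>j\<close> is a positive multiple of
      \<open>q $ j\<close>, and this ratio is the multiple. For \<open>j\<close> outside
      \<open>I\<close> division by zero gives the zero functional, so \<open>\<phi> j\<close> is
      linear for every \<open>j\<close>.\<close>
    define \<phi> where "\<phi> j y = (y $ j \<bullet> q $ j) / (q $ j \<bullet> q $ j)" for j and y :: "quat ^ 'n"
    define U where "U = (\<Inter>j\<in>I. {y. 0 < \<phi> j y})"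
    have \<phi>: "bounded_linear (\<phi> j)" for j
      unfolding \<phi>_def
      by (intro bounded_linear_compose[OF bounded_linear_divide] bounded_linear_inner_left_comp
          bounded_linear_vec_nth)
    have \<phi>_orbit: "\<phi> j (\<Phi> lam T q) = exp (lam j \<bullet> T)" if "j \<in> I" for j T
      using q that by (simp add: \<phi>_def \<Phi>_def E_star_def)
    show ?thesis
    proof (rule smooth_map_onI)
      show "open U"
        unfolding U_def
        by (intro open_INT ballI open_Collect_less continuous_intros
            linear_continuous_on \<phi> finite)
      then show "C_infinity_on (\<lambda>y. \<Sum>j\<in>I. ln (\<phi> j y) *\<^sub>R h j) U"
        by (intro C_infinity_on_sum C_infinity_on_ln \<phi>) (auto simp: U_def)
      show "Phi_orbit lam q \<subseteq> U"
        by (auto simp: Phi_orbit_eq_range U_def \<phi>_orbit)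
      show "(\<Sum>j\<in>I. ln (\<phi> j y) *\<^sub>R h j) = inv_into (range l) \<psi> y" if "y \<in> Phi_orbit lam q" for y
        using that by (auto simp: Phi_orbit_eq_range inv \<phi>_orbit simp flip: h)
    qed
  qed
  ultimately show ?thesis
    using bij by (simp add: diffeomorphism_def)
qed

text \<open>Project orthogonally onto the span of the \<open>lam i\<close>, then carry an
  orthonormal basis \<open>B\<close> of it to the standard basis vectors spanning \<open>V\<close>.
  The kernel is the orthogonal complement of that span, which is
  \<open>K_space lam I\<close>.\<close>

lemma linear_onto_coordinate_space:
  fixes lam :: "'n \<Rightarrow> 'v::euclidean_space" and V :: "'e::euclidean_space set"
  assumes "coordinate_space (rho lam I) V"
  obtains l where "linear l" "\<And>T. l T = 0 \<longleftrightarrow> T \<in> K_space lam I" "range l = V"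
proof -
  obtain C where C: "C \<subseteq> Basis" "card C = rho lam I" "V = span C"
    using assms by (auto simp: coordinate_space_def)
  obtain B where B: "B \<subseteq> span (lam ` I)" "pairwise orthogonal B" "\<And>b. b \<in> B \<Longrightarrow> norm b = 1"
    "independent B" "card B = dim (span (lam ` I))" "span B = span (lam ` I)"
    using orthonormal_basis_subspace[OF subspace_span] by metis
  have fin: "finite B" "finite C"
    using B(4) C(1) by (auto simp: independent_imp_finite intro: finite_subset)
  have "card B = card C"
    using B(5) C(2) by (simp add: rho_def)
  then obtain c where c: "bij_betw c B C"
    using finite_same_card_bij fin by blast
  define l where "l T = (\<Sum>b\<in>B. (b \<bullet> T) *\<^sub>R c b)" for T
  have lin: "linear l"
    by (rule linearI)
      (simp_all add: l_def inner_add_right scaleR_left_distrib sum.distrib scaleR_sum_right)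
  have orthC: "c b \<bullet> c b' = (if b = b' then 1 else 0)" if "b \<in> B" "b' \<in> B" for b b'
    using bij_betwE[OF c] C(1) inj_on_eq_iff[OF bij_betw_imp_inj_on[OF c] that] that
    by (metis inner_Basis subsetD)
  have coeff: "l T \<bullet> c b = b \<bullet> T" if "b \<in> B" for T b
    using that fin by (simp add: l_def inner_sum_left orthC if_distrib cong: if_cong sum.cong)
  have l_B: "l b = c b" if "b \<in> B" for b
  proof -
    have "b' \<bullet> b = (if b' = b then 1 else 0)" if "b' \<in> B" for b'
      using B(2,3) that \<open>b \<in> B\<close>
      by (auto simp: pairwise_def orthogonal_def norm_eq_1)
    then show ?thesis
      using that fin by (simp add: l_def if_distrib[of "\<lambda>x. x *\<^sub>R _"] cong: if_cong sum.cong)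
  qed
  show thesis
  proof
    show "linear l" by (rule lin)
    show "l T = 0 \<longleftrightarrow> T \<in> K_space lam I" for T
    proof -
      \<comment> \<open>The vectors \<open>c b\<close> are orthonormal, so \<open>l T\<close>
        vanishes only if every coefficient does.\<close>
      have "l T = 0 \<longleftrightarrow> (\<forall>b\<in>B. orthogonal T b)"
        using coeff[of _ T] by (auto simp: l_def orthogonal_def inner_commute)
      also have "\<dots> \<longleftrightarrow> (\<forall>b\<in>span B. orthogonal T b)"
        by (meson orthogonal_to_span span_base)
      also have "\<dots> \<longleftrightarrow> (\<forall>b\<in>lam ` I. orthogonal T b)"
        unfolding B(6) by (meson orthogonal_to_span span_base)
      finally show ?thesis
        by (auto simp: K_space_def orthogonal_def inner_commute)
    qed
    have "range l \<subseteq> span C"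
      unfolding l_def using bij_betwE[OF c]
      by (intro image_subsetI span_sum span_scale) (auto intro: span_base)
    moreover have "C \<subseteq> range l"
      using l_B bij_betw_imp_surj_on[OF c] by (metis image_subsetI rangeI)
    then have "span C \<subseteq> range l"
      using lin by (intro span_minimal linear_subspace_image subspace_UNIV)
    ultimately show "range l = V"
      using C(3) by simp
  qed
qed

text \<open>A single chart, defined on all of \<open>span C\<close>, covers the orbit.\<close>

lemma smooth_submanifold_Phi_orbit:
  fixes lam :: "'n::finite \<Rightarrow> 'v::euclidean_space"
  assumes q: "q \<in> E_star I"
  shows "smooth_submanifold (rho lam I) (Phi_orbit lam q)"
proof -
  \<comment> \<open>The model space must lie in the same ambient space as the orbit, which therefore
    needs at least \<open>rho lam I\<close> basis vectors.\<close>
  have "rho lam I \<le> card (lam ` I)"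
    unfolding rho_def by (rule dim_le_card') simp
  also have "\<dots> \<le> CARD('n)"
    by (meson card_image_le card_mono finite order_trans subset_UNIV)
  also have "\<dots> \<le> card (Basis :: (quat ^ 'n) set)"
    by simp
  finally obtain C :: "(quat ^ 'n) set" where "C \<subseteq> Basis" "card C = rho lam I"
    by (meson obtain_subset_with_card_n)
  then have V: "coordinate_space (rho lam I) (span C)"
    by (auto simp: coordinate_space_def)
  then obtain l where l: "linear l" "\<And>T. l T = 0 \<longleftrightarrow> T \<in> K_space lam I" "range l = span C"
    using linear_onto_coordinate_space by blast
  \<comment> \<open>Any preimage under \<open>l\<close> will do: two of them differ by an element of
    \<open>K_space lam I\<close> and move \<open>q\<close> to the same point.\<close>
  define \<psi> where "\<psi> v = \<Phi> lam (inv_into UNIV l v) q" for v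
  have "\<psi> (l T) = \<Phi> lam T q" for T
    unfolding \<psi>_def Phi_eq_iff[OF q] linear_eq_iff_diff_kernel[of l "K_space lam I", OF l(1,2), symmetric]
    by (simp add: f_inv_into_f)
  then have "diffeomorphism (span C) (Phi_orbit lam q) \<psi>"
    using diffeomorphism_Phi_orbit[OF q l(1,2)] l(3) by metis
  then show ?thesis
    unfolding smooth_submanifold_def using V
    by (intro exI[of _ "span C"] conjI ballI exI[of _ UNIV] exI[of _ \<psi>]) auto
qed

lemma manifold_dim_Phi_orbit:
  fixes lam :: "'n::finite \<Rightarrow> 'v::euclidean_space"
  assumes "q \<in> E_star I"
  shows "manifold_dim (Phi_orbit lam q) = rho lam I"
  using smooth_submanifold_Phi_orbit[OF assms] by (rule manifold_dim_eq) (simp add: Phi_orbit_eq_range)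

text \<open>Smoothness on the quotient is read through linear coordinates \<open>L\<close>.
  Quantifying over all \<open>L\<close> makes the diffeomorphism independent of the coordinates, and
  \<open>F\<close> is the map induced by the action itself.\<close>

theorem proposition15p1:
  fixes \<Lambda> :: "'n::finite \<Rightarrow> quat ^ 'm::finite"
    and \<iota> :: "quat ^ 'm \<Rightarrow> real ^ 'p::finite"
    and lam :: "'n \<Rightarrow> real ^ 'p"
    and I :: "'n set"
    and q :: "quat ^ 'n"
  assumes "CARD('p) = 4 * CARD('m)"
    and "isometric_identification \<iota>"
    and "lam = \<iota> \<circ> \<Lambda>"
    and "q \<in> E_star I"
  shows "Phi_isotropy lam q = K_space lam I \<and> subspace (K_space lam I) \<and>
    (\<exists>F. (\<forall>T. F (coset (K_space lam I) T) = \<Phi> lam T q) \<and>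
         bij_betw F (quotient (K_space lam I)) (Phi_orbit lam q) \<and>
         (\<forall>V :: (real ^ 'r::finite) set. coordinate_space (rho lam I) V \<longrightarrow>
            (\<exists>L. quotient_linear_iso (K_space lam I) V L) \<and>
            (\<forall>L. quotient_linear_iso (K_space lam I) V L \<longrightarrow>
               diffeomorphism V (Phi_orbit lam q)
                 (F \<circ> inv_into (quotient (K_space lam I)) L)))) \<and>
    smooth_submanifold (rho lam I) (Phi_orbit lam q) \<and>
    manifold_dim (Phi_orbit lam q) = rho lam I \<and>
    (\<forall>q'. supp q' = supp q \<longrightarrow>
       manifold_dim (Phi_orbit lam q') = manifold_dim (Phi_orbit lam q))"
proof -
  let ?K = "K_space lam I"
  note q = \<open>q \<in> E_star I\<close>
  obtain F where F: "\<And>T. F (coset ?K T) = \<Phi> lam T q"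
    using coset_lift[OF subspace_K_space, of lam I "\<lambda>T. \<Phi> lam T q"] Phi_eq_iff[OF q] by metis
  have "bij_betw F (quotient ?K) (Phi_orbit lam q)"
    unfolding Phi_orbit_eq_range
    by (rule bij_betw_quotient[OF subspace_K_space Phi_eq_iff[OF q] F])
  moreover have "\<exists>L. quotient_linear_iso ?K V L"
    if "coordinate_space (rho lam I) V" for V :: "(real ^ 'r) set"
    using linear_onto_coordinate_space[OF that] quotient_linear_iso_exists[OF subspace_K_space]
    by metis
  moreover have "diffeomorphism V (Phi_orbit lam q) (F \<circ> inv_into (quotient ?K) L)"
    if "quotient_linear_iso ?K V L" for V :: "(real ^ 'r) set" and L
  proof -
    note L = quotient_linear_iso_imp_linear[OF subspace_K_space that]
    have "inj_on L (quotient ?K)"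
      using that by (simp add: quotient_linear_iso_def bij_betw_def)
    \<comment> \<open>This is the condition on \<open>\<psi>\<close> in
      \<open>diffeomorphism_Phi_orbit\<close>, for the linear map sending \<open>T\<close> to
      \<open>L (coset ?K T)\<close>.\<close>
    then have "(F \<circ> inv_into (quotient ?K) L) (L (coset ?K T)) = \<Phi> lam T q" for T
      by (simp add: F inv_into_f_f quotient_eq_range)
    from diffeomorphism_Phi_orbit[OF q L(1,3) this] show ?thesis
      by (simp add: L(2) comp_def)
  qed
  \<comment> \<open>Equal supports put \<open>q'\<close> in \<open>E_star I\<close> too, so both
    dimensions are \<open>rho lam I\<close>.\<close>
  moreover have "manifold_dim (Phi_orbit lam q') = manifold_dim (Phi_orbit lam q)"
    if "supp q' = supp q" for q'
    using that q by (simp add: E_star_iff_supp manifold_dim_Phi_orbit[of _ I])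
  ultimately show ?thesis
    using F by (auto simp: Phi_isotropy_eq[OF q] subspace_K_space
        smooth_submanifold_Phi_orbit[OF q] manifold_dim_Phi_orbit[OF q])
qed

end
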